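(* (1) If the data distribution on $\mathcal{X}\times\{0,1\}$ has an $(\alpha,\beta,\gamma)$ Boltzmann margin ($\alpha,\beta,\gamma>0$), then it has an $\left(\frac{\alpha}{\gamma},\beta\right)$ Tsybakov margin. (2) Reversely, suppose the data distribution has an $(\alpha,\beta)$ Tsybakov margin ($\alpha,\beta>0$), and let $\alpha',\beta',\gamma'>0$ satisfy $\gamma'\le\ln(\alpha'/\alpha)$. Then $$\Pr_X\{|1/2-\eta(X)|\le t\}\le\alpha'\exp(-\gamma' t^{-\beta'})\quad\text{for all } t\in\left[\left(\frac{\gamma'}{\ln(\alpha'/\alpha)}\right)^{1/\beta'},\,0.5\right].$$
   Context: $(X,Y)$ is a random pair in $\mathcal{X}\times\{0,1\}$ (its law is the data distribution) and $\eta(x)=\mathbb{E}[Y\mid X=x]$. $(\alpha,\beta)$ Tsybakov margin: for all $t>0$, $\Pr_X\{|1/2-\eta(X)|\le t\}\le\alpha t^\beta$. $(\alpha,\beta,\gamma)$ Boltzmann margin: for all $t>0$, $\Pr_X\{|1/2-\eta(X)|\le t\}\le\alpha\exp(-\gamma t^{-\beta})$. *)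

theory Defs
  imports "HOL-Probability.Probability"
begin

text \<open>
  The feature space \<open>\<X>\<close> is the measurable space underlying \<open>N\<close> (only \<open>space N\<close> and \<open>sets N\<close>
  are used). The pair \<open>(X, Y)\<close> is represented by its law \<open>D\<close>, with \<open>X = fst\<close> and \<open>Y = snd\<close>;
  the labels are the real numbers 0 and 1.
\<close>

locale data_distribution = prob_space D
  for N :: "'a measure" and D :: "('a \<times> real) measure" +
  assumes sets_D: "sets D = sets (N \<Otimes>\<^sub>M count_space {0, 1})"

definition feature_algebra :: "'a measure \<Rightarrow> ('a \<times> real) measure \<Rightarrow> ('a \<times> real) measure" where
  "feature_algebra N D = vimage_algebra (space D) fst N"

text \<open>
  The library's conditional expectation is a function on the sample space \<open>\<X> \<times> {0, 1}\<close>. Being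
  measurable with respect to the \<open>\<sigma>\<close>-algebra generated by \<open>X\<close>, it does not depend on the label
  (lemma \<open>regression_fun_factor\<close>), so evaluating it at label 0 gives \<open>\<E>[Y | X = x]\<close>.
  The margin conditions do not depend on the version (lemma \<open>margin_mass_version\<close>).
\<close>

definition regression_fun :: "'a measure \<Rightarrow> ('a \<times> real) measure \<Rightarrow> 'a \<Rightarrow> real" where
  "regression_fun N D x = real_cond_exp D (feature_algebra N D) snd (x, 0)"

definition margin_mass :: "'a measure \<Rightarrow> ('a \<times> real) measure \<Rightarrow> real \<Rightarrow> real" where
  "margin_mass N D t = measure (distr D N fst) {x \<in> space N. \<bar>1/2 - regression_fun N D x\<bar> \<le> t}"

definition tsybakov_margin :: "'a measure \<Rightarrow> ('a \<times> real) measure \<Rightarrow> real \<Rightarrow> real \<Rightarrow> bool" where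
  "tsybakov_margin N D \<alpha> \<beta> \<longleftrightarrow> (\<forall>t>0. margin_mass N D t \<le> \<alpha> * t powr \<beta>)"

definition boltzmann_margin ::
    "'a measure \<Rightarrow> ('a \<times> real) measure \<Rightarrow> real \<Rightarrow> real \<Rightarrow> real \<Rightarrow> bool" where
  "boltzmann_margin N D \<alpha> \<beta> \<gamma> \<longleftrightarrow>
     (\<forall>t>0. margin_mass N D t \<le> \<alpha> * exp (- \<gamma> * t powr (- \<beta>)))"

context data_distribution
begin

lemma space_D: "space D = space N \<times> {0, 1}"
  using sets_eq_imp_space_eq[OF sets_D] by (simp add: space_pair_measure)

lemma measurable_D: "measurable D K = measurable (N \<Otimes>\<^sub>M count_space {0, 1}) K"
  by (rule measurable_cong_sets[OF sets_D refl])

lemma fst_measurable: "fst \<in> measurable D N"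
  unfolding measurable_D by measurable

lemma snd_measurable: "snd \<in> borel_measurable D"
proof -
  have "snd \<in> measurable (N \<Otimes>\<^sub>M count_space {0, 1}) (count_space {0, 1 :: real})"
    by measurable
  moreover have "(\<lambda>y. y) \<in> measurable (count_space {0, 1 :: real}) borel"
    by simp
  ultimately show ?thesis
    unfolding measurable_D by (rule measurable_compose)
qed

lemma sets_feature_algebra:
  "sets (feature_algebra N D) = {fst -` A \<inter> space D | A. A \<in> sets N}"
  unfolding feature_algebra_def by (rule sets_vimage_algebra2) (auto simp: space_D)

lemma space_feature_algebra: "space (feature_algebra N D) = space D"
  unfolding feature_algebra_def by simp

lemma subalgebra_feature: "subalgebra D (feature_algebra N D)"
  using measurable_sets[OF fst_measurable]
  by (auto simp: subalgebra_def sets_feature_algebra space_feature_algebra)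

lemma regression_fun_measurable: "regression_fun N D \<in> borel_measurable N"
proof -
  have "(\<lambda>x. (x, 0)) \<in> measurable N (feature_algebra N D)"
    unfolding feature_algebra_def
    by (rule measurable_vimage_algebra2) (auto simp: space_D)
  from measurable_compose[OF this borel_measurable_cond_exp]
  show ?thesis unfolding regression_fun_def .
qed

lemma regression_fun_factor:
  assumes "z \<in> space D"
  shows "regression_fun N D (fst z) = real_cond_exp D (feature_algebra N D) snd z"
proof -
  let ?g = "real_cond_exp D (feature_algebra N D) snd"
  have "?g -` {?g z} \<inter> space (feature_algebra N D) \<in> sets (feature_algebra N D)"
    by (intro measurable_sets[OF borel_measurable_cond_exp]) simp
  then obtain A where "A \<in> sets N" and A: "?g -` {?g z} \<inter> space D = fst -` A \<inter> space D"
    by (auto simp: sets_feature_algebra space_feature_algebra)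
  have "z \<in> fst -` A \<inter> space D"
    using assms A by blast
  then have "(fst z, 0) \<in> fst -` A \<inter> space D"
    by (auto simp: space_D)
  with A show ?thesis
    by (auto simp: regression_fun_def)
qed

lemma margin_mass_version:
  assumes [measurable]: "\<eta> \<in> borel_measurable N"
    and version: "AE z in D. \<eta> (fst z) = real_cond_exp D (feature_algebra N D) snd z"
  shows "measure (distr D N fst) {x \<in> space N. \<bar>1/2 - \<eta> x\<bar> \<le> t} = margin_mass N D t"
proof -
  note [measurable] = regression_fun_measurable fst_measurable
  have "AE z in D. \<eta> (fst z) = regression_fun N D (fst z)"
    using version by (auto simp: regression_fun_factor)
  then have "AE x in distr D N fst. \<eta> x = regression_fun N D x"
    by (subst AE_distr_iff) auto
  then show ?thesis
    unfolding margin_mass_def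
    by (intro measure_eq_AE) auto
qed

end

end

(* Part (1) is exp(-u) <= 1/u at u = \<gamma> t^-\<beta>. In part (2), t <= 1 makes the Tsybakov bound at most
   \<alpha> = \<alpha>' exp(-ln(\<alpha>'/\<alpha>)), and the lower bound on t says exactly \<gamma>' t^-\<beta>' <= ln(\<alpha>'/\<alpha>). *)
theory Submission
  imports Defs
begin

text \<open>Reciprocal form of \<open>u < u + 1 \<le> exp u\<close>; positivity of \<open>u\<close>
  keeps the direction when inverting.\<close>

lemma exp_uminus_le_inverse:
  fixes u :: real
  assumes "u > 0"
  shows "exp (- u) \<le> 1 / u"
proof -
  have "u \<le> exp u"
    using exp_ge_add_one_self[of u] by linarith
  with assms show ?thesis
    by (simp add: exp_minus field_simps)
qed

lemma boltzmann_imp_tsybakov_margin: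
  assumes "\<alpha> > 0" "\<gamma> > 0" "boltzmann_margin N D \<alpha> \<beta> \<gamma>"
  shows "tsybakov_margin N D (\<alpha> / \<gamma>) \<beta>"
  unfolding tsybakov_margin_def
proof (intro allI impI)
  fix t :: real assume t: "t > 0"
  have "margin_mass N D t \<le> \<alpha> * exp (- (\<gamma> * t powr (- \<beta>)))"
    using assms(3) t by (simp add: boltzmann_margin_def)
  also have "\<dots> \<le> \<alpha> * (1 / (\<gamma> * t powr (- \<beta>)))"
    using assms t by (intro mult_left_mono exp_uminus_le_inverse) auto
  \<comment> \<open>Inverting \<open>\<gamma> * t powr (- \<beta>)\<close> flips the sign of the
    exponent and puts \<open>\<gamma>\<close> in the denominator, whence the constant
    \<open>\<alpha> / \<gamma>\<close>.\<close>
  also have "\<dots> = \<alpha> / \<gamma> * t powr \<beta>"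
    by (simp add: powr_minus_divide)
  finally show "margin_mass N D t \<le> \<alpha> / \<gamma> * t powr \<beta>" .
qed

text \<open>The range of \<open>t\<close> extends to 1 because the upper bound serves only to give
  \<open>t powr \<beta> \<le> 1\<close>.\<close>

lemma tsybakov_imp_boltzmann_bound:
  assumes pos: "\<alpha> > 0" "\<beta> > 0" "\<alpha>' > 0" "\<beta>' > 0" "\<gamma>' > 0"
    and margin: "tsybakov_margin N D \<alpha> \<beta>"
    and \<gamma>'_le: "\<gamma>' \<le> ln (\<alpha>' / \<alpha>)"
    and lower: "(\<gamma>' / ln (\<alpha>' / \<alpha>)) powr (1 / \<beta>') \<le> t" and upper: "t \<le> 1"
  shows "margin_mass N D t \<le> \<alpha>' * exp (- \<gamma>' * t powr (- \<beta>'))"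
proof -
  define L where "L = ln (\<alpha>' / \<alpha>)"
  \<comment> \<open>\<open>0 < \<gamma>' \<le> L\<close>, so dividing by \<open>L\<close> is safe
    and preserves order.\<close>
  have L: "L > 0"
    using pos \<gamma>'_le unfolding L_def by linarith
  \<comment> \<open>The left endpoint is strictly positive, which forces \<open>t > 0\<close>, as
    the margin condition requires.\<close>
  have "0 < (\<gamma>' / L) powr (1 / \<beta>')"
    using pos L by simp
  with lower have t: "t > 0"
    unfolding L_def by linarith
  \<comment> \<open>Raising to the power \<open>\<beta>' > 0\<close> is monotone and cancels the
    root in the left endpoint.\<close>
  have "((\<gamma>' / L) powr (1 / \<beta>')) powr \<beta>' \<le> t powr \<beta>'"
    using lower pos by (intro powr_mono2) (auto simp: L_def)
  then have "\<gamma>' / L \<le> t powr \<beta>'"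
    using pos L by (simp add: powr_powr)
  then have exponent: "\<gamma>' * t powr (- \<beta>') \<le> L"
    using t L by (simp add: powr_minus_divide field_simps)
  have "margin_mass N D t \<le> \<alpha> * t powr \<beta>"
    using margin t by (simp add: tsybakov_margin_def)
  also have "\<dots> \<le> \<alpha>"
    using pos t upper by (simp add: powr_le1)
  \<comment> \<open>By the choice of \<open>L\<close>,
    \<open>exp (- L) = \<alpha> / \<alpha>'\<close>.\<close>
  also have "\<alpha> = \<alpha>' * exp (- L)"
    using pos by (simp add: L_def exp_minus)
  also have "\<dots> \<le> \<alpha>' * exp (- \<gamma>' * t powr (- \<beta>'))"
    using pos exponent by simp
  finally show ?thesis .
qed

theorem lemma3p2:
  fixes N :: "'a measure" and D :: "('a \<times> real) measure"
  assumes "data_distribution N D"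
  shows "(\<forall>\<alpha> \<beta> \<gamma>. \<alpha> > 0 \<and> \<beta> > 0 \<and> \<gamma> > 0 \<and> boltzmann_margin N D \<alpha> \<beta> \<gamma>
            \<longrightarrow> tsybakov_margin N D (\<alpha> / \<gamma>) \<beta>)
    \<and> (\<forall>\<alpha> \<beta> \<alpha>' \<beta>' \<gamma>'. \<alpha> > 0 \<and> \<beta> > 0 \<and> tsybakov_margin N D \<alpha> \<beta>
            \<and> \<alpha>' > 0 \<and> \<beta>' > 0 \<and> \<gamma>' > 0 \<and> \<gamma>' \<le> ln (\<alpha>' / \<alpha>)
            \<longrightarrow> (\<forall>t \<in> {(\<gamma>' / ln (\<alpha>' / \<alpha>)) powr (1 / \<beta>') .. 1/2}.
                   margin_mass N D t \<le> \<alpha>' * exp (- \<gamma>' * t powr (- \<beta>'))))"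
proof (intro conjI allI impI ballI; elim conjE)
  fix \<alpha> \<beta> \<gamma> :: real
  assume "\<alpha> > 0" "\<gamma> > 0" "boltzmann_margin N D \<alpha> \<beta> \<gamma>"
  then show "tsybakov_margin N D (\<alpha> / \<gamma>) \<beta>"
    by (rule boltzmann_imp_tsybakov_margin)
next
  fix \<alpha> \<beta> \<alpha>' \<beta>' \<gamma>' t :: real
  assume "\<alpha> > 0" "\<beta> > 0" "\<alpha>' > 0" "\<beta>' > 0" "\<gamma>' > 0" "tsybakov_margin N D \<alpha> \<beta>"
    "\<gamma>' \<le> ln (\<alpha>' / \<alpha>)" "t \<in> {(\<gamma>' / ln (\<alpha>' / \<alpha>)) powr (1 / \<beta>') .. 1/2}"
  then show "margin_mass N D t \<le> \<alpha>' * exp (- \<gamma>' * t powr (- \<beta>'))"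
    \<comment> \<open>The interval gives \<open>t \<le> 1/2\<close>, hence
      \<open>t \<le> 1\<close>.\<close>
    by (intro tsybakov_imp_boltzmann_bound) auto
qed

end
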